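(* If $k, r \in \mathbb{N}$ and $\mathbb{N}$ is $r$-colored, then there exist $a, b, d \in \mathbb{N}$ and $\gamma \in \mathcal{P}_f(\mathbb{N})$ such that the set $$\left\{\left|\Sigma_{< s_b \left(\left(\prod_{t \in \gamma} s_t\right) \cdot s_{a + i d}\right)^j}\right| : i, j = 0, 1, 2, \ldots, k\right\}$$ is monochromatic.
   Context: $\mathbb{N}_0$ denotes the nonnegative integers and $\mathbb{N}$ the positive integers. $\mathcal{P}_f(\mathbb{N})$ is the set of all finite nonempty subsets of $\mathbb{N}$. $\Sigma = \{u^2+v^2 : u,v \in \mathbb{N}_0\}$ is the set of sums of two squares, which is closed under multiplication; it is enumerated increasingly as $\Sigma = \{s_0 < s_1 < s_2 < \cdots\}$ (so $s_0=0$, $s_1=1$, $s_2=2$, $s_3=4$, $s_4=5,\dots$). For $s \in \Sigma$, $\Sigma_{<s} = \{y \in \Sigma : y < s\}$. A set is monochromatic if it is contained in a single color class. *)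

theory Defs
  imports Complex_Main "HOL-Library.Infinite_Set" "HOL-Library.FuncSet"
begin

definition two_squares :: "nat set" where
  "two_squares = {u^2 + v^2 | u v. True}"

(* The index set of the enumeration starts at 0, so that ts 0 = 0, ts 1 = 1, ts 2 = 2, ts 3 = 4. *)
definition ts :: "nat \<Rightarrow> nat" where
  "ts n = enumerate two_squares n"

definition two_squares_below :: "nat \<Rightarrow> nat set" where
  "two_squares_below x = {y \<in> two_squares. y < x}"

(* The positive integers are the set {1..} of type nat set. *)
definition coloring :: "nat \<Rightarrow> (nat \<Rightarrow> nat) \<Rightarrow> bool" where
  "coloring r c \<longleftrightarrow> c \<in> {1..} \<rightarrow> {1..r}"

definition color_class :: "(nat \<Rightarrow> nat) \<Rightarrow> nat \<Rightarrow> nat set" where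
  "color_class c m = {n \<in> {1..}. c n = m}"

definition monochromatic :: "nat \<Rightarrow> (nat \<Rightarrow> nat) \<Rightarrow> nat set \<Rightarrow> bool" where
  "monochromatic r c A \<longleftrightarrow> (\<exists>m\<in>{1..r}. A \<subseteq> color_class c m)"

text \<open>Since the enumeration is only meaningful on an infinite set, we record that it really
  is the increasing enumeration of the sums of two squares.\<close>

lemma infinite_two_squares: "infinite two_squares"
proof -
  have "inj (\<lambda>u::nat. u^2)"
    by (auto simp: inj_on_def)
  then have "infinite (range (\<lambda>u::nat. u^2))"
    by (rule range_inj_infinite)
  moreover have "range (\<lambda>u::nat. u^2) \<subseteq> two_squares"
    unfolding two_squares_def by (auto intro: exI[of _ "0::nat"])
  ultimately show ?thesis
    using finite_subset by blast
qed

lemma strict_mono_ts: "strict_mono ts"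
  unfolding ts_def using strict_mono_enumerate[OF infinite_two_squares] by simp

lemma range_ts: "range ts = two_squares"
  unfolding ts_def using range_enumerate[OF infinite_two_squares] by simp

end

theory Submission
  imports Defs
begin

text \<open>
  Let \<open>M\<close> be a commutative monoid and \<open>f\<close> a map from the positive integers to \<open>M\<close>. For fixed
  \<open>x\<close>, the Hales--Jewett theorem applied to the words \<open>w\<close> over \<open>{0..k}\<close>, coloured by the colour
  of \<open>\<Prod>\<^sub>t f(x\<^sub>t)^(w\<^sub>t)\<close>, gives a monochromatic combinatorial line. Only finitely many lines
  and colours are possible, so Gallai's theorem gives a grid on which the vector \<open>x\<close> can move
  without changing the line and its colour. Pick one active coordinate of the line, let it run
  through an arithmetic progression and keep all other coordinates of \<open>x\<close> fixed: the points
  of the lines are then \<open>b (P f(a + i d))^j\<close> with \<open>b\<close> and \<open>P\<close> independent of \<open>i\<close> and \<open>j\<close>.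
  For sums of two squares, \<open>P\<close> is itself some \<open>s\<^sub>m\<close>, so that a singleton \<open>\<gamma>\<close> suffices.
\<close>

section \<open>The Hales--Jewett theorem\<close>

definition words :: "'a set \<Rightarrow> nat \<Rightarrow> 'a list set" where
  "words A n = {w. set w \<subseteq> A \<and> length w = n}"

text \<open>\<open>None\<close> is the variable of a variable word.\<close>

definition variable_words :: "'a set \<Rightarrow> nat \<Rightarrow> 'a option list set" where
  "variable_words A n = {v. set v \<subseteq> insert None (Some ` A) \<and> length v = n \<and> None \<in> set v}"

definition fill :: "'a option list \<Rightarrow> 'a \<Rightarrow> 'a list" where
  "fill v a = map (case_option a id) v"

definition mono_line :: "'a set \<Rightarrow> nat \<Rightarrow> ('a list \<Rightarrow> 'b) \<Rightarrow> bool" where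
  "mono_line A n c \<longleftrightarrow> (\<exists>v\<in>variable_words A n. \<exists>col. \<forall>a\<in>A. c (fill v a) = col)"

definition hales_jewett :: "'a set \<Rightarrow> nat \<Rightarrow> nat \<Rightarrow> bool" where
  "hales_jewett A r n \<longleftrightarrow> (\<forall>c \<in> words A n \<rightarrow> {..<r}. mono_line A n c)"

lemma finite_words: "finite A \<Longrightarrow> finite (words A n)"
  unfolding words_def by (rule finite_lists_length_eq)

lemma finite_variable_words: "finite A \<Longrightarrow> finite (variable_words A n)"
  by (rule finite_subset[OF _ finite_words[of "insert None (Some ` A)" n]])
     (auto simp: variable_words_def words_def)

lemma append_words: "u \<in> words A m \<Longrightarrow> w \<in> words A n \<Longrightarrow> u @ w \<in> words A (m + n)"
  by (auto simp: words_def)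

lemma fill_append: "fill (v @ w) a = fill v a @ fill w a"
  by (simp add: fill_def)

lemma fill_map_Some: "fill (map Some w) a = w"
  by (induction w) (auto simp: fill_def)

lemma fill_words: "v \<in> variable_words A n \<Longrightarrow> a \<in> A \<Longrightarrow> fill v a \<in> words A n"
  by (fastforce simp: variable_words_def words_def fill_def split: option.splits)

lemma variable_words_mono: "A \<subseteq> B \<Longrightarrow> variable_words A n \<subseteq> variable_words B n"
  by (auto simp: variable_words_def)

lemma append_variable_words:
  "v \<in> variable_words A m \<Longrightarrow> w \<in> variable_words A n \<Longrightarrow> v @ w \<in> variable_words A (m + n)"
  by (auto simp: variable_words_def)

lemma variable_word_append_word:
  "v \<in> variable_words A m \<Longrightarrow> w \<in> words A n \<Longrightarrow> v @ map Some w \<in> variable_words A (m + n)"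
  by (auto simp: variable_words_def words_def)

lemma word_append_variable_word:
  "w \<in> words A m \<Longrightarrow> v \<in> variable_words A n \<Longrightarrow> map Some w @ v \<in> variable_words A (m + n)"
  by (auto simp: variable_words_def words_def)

text \<open>Colours are renamed along a bijection between \<open>B\<close> and
  \<open>{..<card B}\<close>. This allows colours that are themselves functions or pairs. A letter
  of the nonempty \<open>A\<close> witnesses that the colour of the line lies in
  \<open>B\<close>.\<close>

lemma hales_jewett_finite_colours:
  assumes "hales_jewett A (card B) n" and "finite B" and c: "c \<in> words A n \<rightarrow> B"
    and "A \<noteq> {}"
  shows "\<exists>v\<in>variable_words A n. \<exists>col\<in>B. \<forall>a\<in>A. c (fill v a) = col"
proof -
  obtain g where g: "bij_betw g B {..<card B}"
    using ex_bij_betw_finite_nat[OF \<open>finite B\<close>] by (auto simp: atLeast0LessThan)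
  have "g \<circ> c \<in> words A n \<rightarrow> {..<card B}"
    using c bij_betwE[OF g] by (auto simp: Pi_iff)
  then obtain v col where v: "v \<in> variable_words A n" and col: "\<And>a. a \<in> A \<Longrightarrow> g (c (fill v a)) = col"
    using assms(1) unfolding hales_jewett_def mono_line_def by fastforce
  have B: "c (fill v a) \<in> B" if "a \<in> A" for a
    using c fill_words[OF v that] by auto
  obtain a0 where "a0 \<in> A" using \<open>A \<noteq> {}\<close> by blast
  have "c (fill v a) = c (fill v a0)" if "a \<in> A" for a
    using col[OF that] col[OF \<open>a0 \<in> A\<close>] B[OF that] B[OF \<open>a0 \<in> A\<close>] g
    by (auto simp: bij_betw_def inj_on_def)
  with v B[OF \<open>a0 \<in> A\<close>] show ?thesis by blast
qed

text \<open>The lines through the common point \<open>f\<close> carry pairwise distinct colours \<open>K\<close> away from \<open>f\<close>.\<close>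

definition focused :: "'a set \<Rightarrow> 'a \<Rightarrow> nat \<Rightarrow> ('a list \<Rightarrow> 'b) \<Rightarrow> 'a list \<Rightarrow> 'b set \<Rightarrow> bool" where
  "focused A z n c f K \<longleftrightarrow> f \<in> words (insert z A) n \<and>
     (\<forall>col\<in>K. \<exists>v\<in>variable_words (insert z A) n. fill v z = f \<and> (\<forall>a\<in>A. c (fill v a) = col))"

text \<open>Induction on \<open>s\<close>: each round either completes a monochromatic line or adds
  one line of a new colour through a common focus. The assumption \<open>IH\<close> for the smaller
  alphabet \<open>A\<close> is applied with a huge number of colours.\<close>

lemma colour_focusing:
  assumes "finite A" and "A \<noteq> {}" and IH: "\<And>r. \<exists>n. hales_jewett A r n"
  shows "\<exists>n. \<forall>c \<in> words (insert z A) n \<rightarrow> {..<r::nat}. mono_line (insert z A) n c \<or>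
           (\<exists>f K. K \<subseteq> {..<r} \<and> card K = s \<and> focused A z n c f K)"
proof (induction s)
  case 0
  have "focused A z 0 c [] {}" for c :: "'a list \<Rightarrow> nat"
    by (auto simp: focused_def words_def)
  then show ?case
    by (intro exI[of _ 0]) force
next
  case (Suc s)
  let ?B = "insert z A"
  obtain m where m: "\<And>c. c \<in> words ?B m \<rightarrow> {..<r} \<Longrightarrow> mono_line ?B m c \<or>
      (\<exists>f K. K \<subseteq> {..<r} \<and> card K = s \<and> focused A z m c f K)"
    using Suc.IH by metis
  \<comment> \<open>A prefix of length \<open>n\<close> is coloured by the whole colouring it
    induces on suffixes of length \<open>m\<close>; \<open>F\<close> is the finite set of these
    colours.\<close>
  define F where "F = PiE (words ?B m) (\<lambda>_. {..<r})"
  have "finite F"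
    using assms(1) unfolding F_def by (intro finite_PiE) (auto intro: finite_words)
  obtain n where n: "hales_jewett A (card F) n"
    using IH by blast
  have "mono_line ?B (n + m) c \<or> (\<exists>f K. K \<subseteq> {..<r} \<and> card K = Suc s \<and> focused A z (n + m) c f K)"
    if c: "c \<in> words ?B (n + m) \<rightarrow> {..<r}" for c
  proof -
    have words_B: "w \<in> words ?B n" if "w \<in> words A n" for w
      using that by (auto simp: words_def)
    have "(\<lambda>u. restrict (\<lambda>w. c (u @ w)) (words ?B m)) \<in> words A n \<rightarrow> F"
      using c words_B by (auto simp: F_def intro!: append_words)
    from hales_jewett_finite_colours[OF n \<open>finite F\<close> this \<open>A \<noteq> {}\<close>]
    obtain v g where v: "v \<in> variable_words A n"
      and g: "\<And>a. a \<in> A \<Longrightarrow> restrict (\<lambda>w. c (fill v a @ w)) (words ?B m) = g"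
      by blast
    have v': "v \<in> variable_words ?B n"
      using v variable_words_mono[of A ?B n] by blast
    obtain a0 where a0: "a0 \<in> A" using \<open>A \<noteq> {}\<close> by blast
    \<comment> \<open>The prefixes \<open>fill v a\<close> with \<open>a\<close> in \<open>A\<close>
      all induce this same colouring of suffixes; nothing is known about the prefix
      \<open>fill v z\<close>.\<close>
    define c' where "c' = (\<lambda>w. c (fill v a0 @ w))"
    have c': "c (fill v a @ w) = c' w" if "a \<in> A" "w \<in> words ?B m" for a w
      using g[OF that(1)] g[OF a0] that(2) unfolding c'_def by (metis restrict_apply')
    have a0w: "fill v a0 \<in> words ?B n"
      using fill_words[OF v a0] words_B by blast
    have c'r: "c' \<in> words ?B m \<rightarrow> {..<r}"
      using c a0w by (auto simp: c'_def intro!: append_words)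
    have lift: "mono_line ?B (n + m) c" if line: "mono_line ?B m c'"
    proof -
      obtain w col where w: "w \<in> variable_words ?B m" and "\<forall>a\<in>?B. c' (fill w a) = col"
        using line unfolding mono_line_def by blast
      then have "\<forall>a\<in>?B. c (fill (map Some (fill v a0) @ w) a) = col"
        by (simp add: fill_append fill_map_Some c'_def)
      with word_append_variable_word[OF a0w w] show ?thesis
        unfolding mono_line_def by blast
    qed
    consider "mono_line ?B m c'" | f K where "K \<subseteq> {..<r}" "card K = s" "focused A z m c' f K"
      using m[OF c'r] by blast
    then show ?thesis
    proof cases
      case 1
      then show ?thesis using lift by blast
    next
      case 2
      have f: "f \<in> words ?B m" using 2(3) by (simp add: focused_def)
      show ?thesis
      proof (cases "c' f \<in> K")
        case True
        \<comment> \<open>The focus shares its colour with one of its lines, so that line stays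
          monochromatic when the letter \<open>z\<close> is added.\<close>
        then obtain w where w: "w \<in> variable_words ?B m" "fill w z = f" "\<forall>a\<in>A. c' (fill w a) = c' f"
          using 2(3) unfolding focused_def by blast
        then have "\<forall>a\<in>?B. c' (fill w a) = c' f" by simp
        then show ?thesis
          using lift w(1) unfolding mono_line_def by blast
      next
        case False
        \<comment> \<open>The new focus is \<open>fill v z @ f\<close>. Each old line is prefixed by
          \<open>v\<close>, so that both parts vary together and the old colour survives; the line
          varying \<open>v\<close> alone, with suffix \<open>f\<close>, contributes the fresh colour
          \<open>c' f\<close>.\<close>
        have "\<exists>w\<in>variable_words ?B (n + m). fill w z = fill v z @ f \<and> (\<forall>a\<in>A. c (fill w a) = col)"
          if "col \<in> insert (c' f) K" for col
        proof (cases "col \<in> K")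
          case True
          then obtain w where w: "w \<in> variable_words ?B m" "fill w z = f" "\<forall>a\<in>A. c' (fill w a) = col"
            using 2(3) unfolding focused_def by blast
          have "c (fill (v @ w) a) = col" if "a \<in> A" for a
            using that w(3) c'[OF that, of "fill w a"] fill_words[OF w(1), of a]
            by (simp add: fill_append)
          with append_variable_words[OF v' w(1)] w(2) show ?thesis
            by (intro bexI[of _ "v @ w"]) (auto simp: fill_append)
        next
          case False
          then have col: "col = c' f" using that by simp
          show ?thesis
            using variable_word_append_word[OF v' f] c'[OF _ f] col
            by (intro bexI[of _ "v @ map Some f"]) (auto simp: fill_append fill_map_Some)
        qed
        moreover have "fill v z @ f \<in> words ?B (n + m)"
          using append_words[OF fill_words[OF v'] f] by simp
        ultimately have "focused A z (n + m) c (fill v z @ f) (insert (c' f) K)"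
          unfolding focused_def by blast
        moreover have "insert (c' f) K \<subseteq> {..<r}"
          using 2(1) c'r f by auto
        moreover have "card (insert (c' f) K) = Suc s"
          using False 2(1,2) finite_subset by fastforce
        ultimately show ?thesis by blast
      qed
    qed
  qed
  then show ?case by blast
qed

text \<open>Induction on the alphabet. Focusing with \<open>s = Suc r\<close> must end in a
  monochromatic line, as \<open>r\<close> colours cannot supply \<open>Suc r\<close> distinct ones.
  Focusing needs a nonempty \<open>A\<close>, so one-letter alphabets are treated separately, where
  every line is monochromatic.\<close>

theorem hales_jewett_exists:
  assumes "finite A"
  shows "\<exists>n. hales_jewett A r n"
  using assms
proof (induction A arbitrary: r rule: finite_induct)
  case empty
  have "[None] \<in> variable_words ({} :: 'a set) 1"
    by (simp add: variable_words_def)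
  then show ?case
    unfolding hales_jewett_def mono_line_def by blast
next
  case (insert z A)
  show ?case
  proof (cases "A = {}")
    case True
    have "[None] \<in> variable_words {z} 1"
      by (simp add: variable_words_def)
    then show ?thesis
      using True unfolding hales_jewett_def mono_line_def by blast
  next
    case False
    obtain n where n: "\<And>c. c \<in> words (insert z A) n \<rightarrow> {..<r} \<Longrightarrow> mono_line (insert z A) n c \<or>
        (\<exists>f K. K \<subseteq> {..<r} \<and> card K = Suc r \<and> focused A z n c f K)"
      using colour_focusing[OF \<open>finite A\<close> False insert.IH, of z r "Suc r"] by metis
    have "card K \<noteq> Suc r" if "K \<subseteq> {..<r}" for K
      using card_mono[OF _ that] by simp
    with n show ?thesis
      unfolding hales_jewett_def by blast
  qed
qed

corollary hales_jewett_theorem: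
  fixes B :: "'b set"
  assumes "finite A" and "A \<noteq> {}" and "finite B"
  obtains n where "\<And>c. c \<in> words A n \<rightarrow> B \<Longrightarrow>
    \<exists>v\<in>variable_words A n. \<exists>col\<in>B. \<forall>a\<in>A. c (fill v a) = col"
  using hales_jewett_exists[OF assms(1)] hales_jewett_finite_colours[OF _ assms(3) _ assms(2)]
  by metis

section \<open>Gallai's theorem\<close>

text \<open>Hales--Jewett is applied with the grid points as letters, and a word is mapped to the
  sum of its letters. A line then becomes a translated and dilated grid: the constant letters add up
  to the translation and \<open>d\<close> counts the occurrences of the variable.\<close>

theorem gallai:
  fixes k n :: nat and c :: "(nat \<Rightarrow> nat) \<Rightarrow> 'b"
  assumes "finite B" and c: "\<And>x. (\<And>t. x t \<ge> 1) \<Longrightarrow> c x \<in> B"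
  obtains \<alpha> :: "nat \<Rightarrow> nat" and d :: nat and col where
    "\<And>t. \<alpha> t \<ge> 1" and "d \<ge> 1" and "col \<in> B"
    and "\<And>y. y \<in> {..<n} \<rightarrow>\<^sub>E {..k} \<Longrightarrow> c (\<lambda>t. \<alpha> t + d * (if t < n then y t else 0)) = col"
proof -
  define A where "A = ({..<n} \<rightarrow>\<^sub>E {..k})"
  have "finite A" "A \<noteq> {}"
    by (auto simp: A_def PiE_eq_empty_iff intro!: finite_PiE)
  then obtain N where N: "\<And>c. c \<in> words A N \<rightarrow> B \<Longrightarrow>
      \<exists>v\<in>variable_words A N. \<exists>col\<in>B. \<forall>a\<in>A. c (fill v a) = col"
    using hales_jewett_theorem \<open>finite B\<close> by metis
  define ev where "ev y t = (if t < n then y t else 0)" for y :: "nat \<Rightarrow> nat" and t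
  \<comment> \<open>The summand 1 keeps every coordinate positive, where \<open>c\<close> is
    controlled.\<close>
  define X where "X w t = 1 + sum_list (map (\<lambda>y. ev y t) w)" for w t
  have "(\<lambda>w. c (X w)) \<in> words A N \<rightarrow> B"
    by (auto simp: X_def intro!: c)
  from N[OF this] obtain v col where v: "v \<in> variable_words A N" and "col \<in> B"
    and col: "\<And>y. y \<in> A \<Longrightarrow> c (X (fill v y)) = col"
    by blast
  define \<alpha> where "\<alpha> t = 1 + sum_list (map (case_option 0 (\<lambda>y. ev y t)) v)" for t
  define d where "d = count_list v None"
  have sum: "sum_list (map (\<lambda>y. ev y t) (fill u y)) =
      sum_list (map (case_option 0 (\<lambda>y. ev y t)) u) + count_list u None * ev y t" for u t y
    by (induction u) (auto simp: fill_def algebra_simps split: option.splits)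
  have X: "X (fill v y) = (\<lambda>t. \<alpha> t + d * ev y t)" for y
    by (auto simp: X_def \<alpha>_def d_def sum)
  have "d \<ge> 1"
    using v count_list_0_iff[of v None] unfolding d_def variable_words_def by (simp add: Suc_le_eq)
  show thesis
    by (rule that[of \<alpha> d col])
       (use \<open>d \<ge> 1\<close> \<open>col \<in> B\<close> col in \<open>auto simp: \<alpha>_def A_def X ev_def\<close>)
qed

section \<open>Geometric progressions with ratios along an arithmetic progression\<close>

theorem geo_arithmetic:
  fixes f :: "nat \<Rightarrow> 'm::comm_monoid_mult" and C :: "'m \<Rightarrow> 'b"
  assumes "1 \<in> M" and mult: "\<And>x y. x \<in> M \<Longrightarrow> y \<in> M \<Longrightarrow> x * y \<in> M"
    and f: "\<And>n. n \<ge> 1 \<Longrightarrow> f n \<in> M" and "finite B" and C: "C \<in> M \<rightarrow> B"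
  obtains a d :: nat and b P col where "a \<ge> 1" and "d \<ge> 1" and "b \<in> M" and "P \<in> M" and "col \<in> B"
    and "\<And>i j. i \<le> k \<Longrightarrow> j \<le> k \<Longrightarrow> C (b * (P * f (a + i * d)) ^ j) = col"
proof -
  have pow: "x ^ j \<in> M" if "x \<in> M" for x :: 'm and j
    using that by (induction j) (auto intro: mult \<open>1 \<in> M\<close>)
  have prod: "(\<Prod>t\<in>T. h t) \<in> M" if "\<And>t. t \<in> T \<Longrightarrow> h t \<in> M" for T :: "nat set" and h :: "nat \<Rightarrow> 'm"
    using that by (induction T rule: infinite_finite_induct) (auto intro: mult \<open>1 \<in> M\<close>)
  obtain n where n: "\<And>c. c \<in> words {..k} n \<rightarrow> B \<Longrightarrow>
      \<exists>v\<in>variable_words {..k} n. \<exists>col\<in>B. \<forall>a\<in>{..k}. c (fill v a) = col"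
    using hales_jewett_theorem[OF finite_atMost _ \<open>finite B\<close>] by (metis atMost_iff empty_iff le_refl)
  define g where "g x w = (\<Prod>t<n. f (x t) ^ (w ! t))" for x :: "nat \<Rightarrow> nat" and w :: "nat list"
  have ex: "\<exists>p. p \<in> variable_words {..k} n \<times> B \<and> (\<forall>j\<le>k. C (g x (fill (fst p) j)) = snd p)"
    if "\<And>t. x t \<ge> 1" for x
  proof -
    have "(\<lambda>w. C (g x w)) \<in> words {..k} n \<rightarrow> B"
      using C that by (auto simp: g_def intro!: funcset_mem[OF C] prod pow f)
    from n[OF this] show ?thesis by fastforce
  qed
  \<comment> \<open>Choosing one line and its colour for every \<open>x\<close> gives a colouring of
    the vectors by finitely many pairs, to which Gallai's theorem applies.\<close>
  define L where "L x = (SOME p. p \<in> variable_words {..k} n \<times> B \<and>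
      (\<forall>j\<le>k. C (g x (fill (fst p) j)) = snd p))" for x
  have L: "L x \<in> variable_words {..k} n \<times> B" "\<forall>j\<le>k. C (g x (fill (fst (L x)) j)) = snd (L x)"
    if "\<And>t. x t \<ge> 1" for x
    using someI_ex[OF ex[of x, OF that], folded L_def] by simp_all
  have fin: "finite (variable_words {..k} n \<times> B)"
    using \<open>finite B\<close> by (simp add: finite_variable_words)
  obtain \<alpha> d p where \<alpha>: "\<And>t. \<alpha> t \<ge> 1" and "d \<ge> 1" and p: "p \<in> variable_words {..k} n \<times> B"
    and grid: "\<And>y. y \<in> {..<n} \<rightarrow>\<^sub>E {..k} \<Longrightarrow> L (\<lambda>t. \<alpha> t + d * (if t < n then y t else 0)) = p"
    by (rule gallai[where c = L and n = n and k = k, OF fin L(1)]) (assumption, rule that)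
  obtain v col where vcol: "p = (v, col)" "v \<in> variable_words {..k} n" "col \<in> B"
    using p by auto
  obtain t0 where t0: "t0 < n" "v ! t0 = None"
    using vcol(2) by (auto simp: variable_words_def in_set_conv_nth)
  have len: "length v = n"
    using vcol(2) by (simp add: variable_words_def)
  \<comment> \<open>Coordinates in \<open>T\<close> have fixed exponents and form \<open>b\<close>.
    The active ones have exponent \<open>j\<close>: those in \<open>U\<close> stay at
    \<open>\<alpha> t\<close> and form \<open>P\<close>, while \<open>t0\<close> alone
    moves.\<close>
  define T where "T = {t. t < n \<and> v ! t \<noteq> None}"
  define U where "U = {t. t < n \<and> v ! t = None \<and> t \<noteq> t0}"
  have split: "{..<n} = T \<union> insert t0 U" "finite T" "finite U" "T \<inter> insert t0 U = {}" "t0 \<notin> U"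
    using t0 by (auto simp: T_def U_def)
  define b where "b = (\<Prod>t\<in>T. f (\<alpha> t) ^ the (v ! t))"
  define P where "P = (\<Prod>t\<in>U. f (\<alpha> t))"
  have main: "C (b * (P * f (\<alpha> t0 + i * d)) ^ j) = col" if "i \<le> k" "j \<le> k" for i j
  proof -
    define x where "x = \<alpha>(t0 := \<alpha> t0 + i * d)"
    \<comment> \<open>This grid point moves only \<open>t0\<close>, by \<open>d * i\<close>; hence
      \<open>i\<close> enters the product through a single factor.\<close>
    define y where "y = (\<lambda>t\<in>{..<n}. if t = t0 then i else 0)"
    have y: "y \<in> {..<n} \<rightarrow>\<^sub>E {..k}"
      using that by (auto simp: y_def)
    have "(\<lambda>t. \<alpha> t + d * (if t < n then y t else 0)) = x"
      using t0(1) by (auto simp: x_def y_def)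
    with grid[OF y] have "L x = (v, col)"
      using vcol(1) by simp
    moreover have "x t \<ge> 1" for t
      using \<alpha> by (simp add: x_def trans_le_add1)
    ultimately have "C (g x (fill v j)) = col"
      using L(2)[of x] that by simp
    moreover have "g x (fill v j) = b * (P * f (\<alpha> t0 + i * d)) ^ j"
    proof -
      have "g x (fill v j) = (\<Prod>t\<in>T. f (x t) ^ (fill v j ! t)) *
          (f (x t0) ^ (fill v j ! t0) * (\<Prod>t\<in>U. f (x t) ^ (fill v j ! t)))"
        unfolding g_def split(1) using split by (simp add: prod.union_disjoint mult.left_commute)
      also have "(\<Prod>t\<in>T. f (x t) ^ (fill v j ! t)) = b"
        unfolding b_def using t0 len
        by (intro prod.cong) (auto simp: T_def x_def fill_def)
      also have "(\<Prod>t\<in>U. f (x t) ^ (fill v j ! t)) = (\<Prod>t\<in>U. f (\<alpha> t) ^ j)"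
        using len by (intro prod.cong) (auto simp: U_def x_def fill_def)
      also have "\<dots> = P ^ j"
        unfolding P_def by (induction j) (simp_all add: prod.distrib)
      also have "f (x t0) ^ (fill v j ! t0) = f (\<alpha> t0 + i * d) ^ j"
        using t0 len by (simp add: x_def fill_def)
      finally show ?thesis
        by (simp add: power_mult_distrib mult.commute)
    qed
    ultimately show ?thesis by simp
  qed
  have "b \<in> M" "P \<in> M"
    using \<alpha> by (auto simp: b_def P_def intro!: prod pow f)
  with main \<alpha> \<open>d \<ge> 1\<close> vcol(3) show thesis
    by (intro that[of "\<alpha> t0" d b P col]) auto
qed

section \<open>Sums of two squares\<close>

text \<open>Brahmagupta's identity; one base is \<open>\<bar>p v - q u\<bar>\<close>, hence the detour through the integers.\<close>

lemma two_squares_mult: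
  assumes "x \<in> two_squares" and "y \<in> two_squares"
  shows "x * y \<in> two_squares"
proof -
  obtain p q u v where x: "x = p^2 + q^2" and y: "y = u^2 + v^2"
    using assms by (auto simp: two_squares_def)
  define w where "w = nat \<bar>int p * int v - int q * int u\<bar>"
  have "int (x * y) = int ((p * u + q * v)^2 + w^2)"
    by (simp add: x y w_def power2_eq_square algebra_simps flip: abs_mult)
  then have "x * y = (p * u + q * v)^2 + w^2"
    by (simp only: of_nat_eq_iff)
  then show ?thesis
    unfolding two_squares_def by blast
qed

lemma ts_0: "ts 0 = 0"
proof -
  have "0 \<in> two_squares"
    by (auto simp: two_squares_def)
  then obtain n where "ts n = 0"
    using range_ts by (metis imageE)
  then show ?thesis
    using strict_mono_ts by (metis le_zero_eq strict_mono_less_eq zero_le)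
qed

text \<open>As the enumeration starts at index 0, exactly the terms with indices below
  \<open>n\<close> precede \<open>ts n\<close>. Counting thus inverts \<open>ts\<close>, and a
  colouring of indices becomes a colouring of sums of two squares.\<close>

lemma card_two_squares_below_ts: "card (two_squares_below (ts n)) = n"
proof -
  have "two_squares_below (ts n) = ts ` {..<n}"
    unfolding two_squares_below_def range_ts[symmetric]
    using strict_mono_less[OF strict_mono_ts] by auto
  moreover have "inj_on ts {..<n}"
    using strict_mono_imp_inj_on[OF strict_mono_ts] by (meson inj_on_subset subset_UNIV)
  ultimately show ?thesis
    by (simp add: card_image)
qed

lemma pos_two_squares_conv_ts:
  assumes "x \<in> two_squares" and "x > 0"
  obtains m where "m \<ge> 1" and "x = ts m"
proof -
  obtain m where "x = ts m"
    using assms(1) range_ts by (metis imageE)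
  moreover from this have "m \<noteq> 0"
    using assms(2) ts_0 by (intro notI) simp
  ultimately show thesis
    by (intro that[of m]) simp_all
qed

theorem theorem5p5:
  fixes k r :: nat and c :: "nat \<Rightarrow> nat"
  assumes "k \<ge> 1" and "r \<ge> 1" and "coloring r c"
  shows "\<exists>a b d :: nat. \<exists>\<gamma> :: nat set.
           a \<ge> 1 \<and> b \<ge> 1 \<and> d \<ge> 1 \<and> finite \<gamma> \<and> \<gamma> \<noteq> {} \<and> \<gamma> \<subseteq> {1..} \<and>
           monochromatic r c
             {card (two_squares_below (ts b * ((\<Prod>t\<in>\<gamma>. ts t) * ts (a + i * d)) ^ j)) | i j.
                i \<in> {0..k} \<and> j \<in> {0..k}}"
proof -
  \<comment> \<open>Zero is excluded because its index is 0, which lies outside the coloured set;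
    the rest is still a multiplicative monoid.\<close>
  define M where "M = {x \<in> two_squares. x > 0}"
  define idx where "idx x = card (two_squares_below x)" for x
  have "1 = (1::nat)^2 + 0^2"
    by simp
  then have "1 \<in> two_squares"
    unfolding two_squares_def by blast
  then have one: "1 \<in> M"
    by (simp add: M_def)
  have mult: "x * y \<in> M" if "x \<in> M" "y \<in> M" for x y
    using that by (auto simp: M_def two_squares_mult)
  have tsM: "ts n \<in> M" if "n \<ge> 1" for n
  proof -
    have "ts n \<in> two_squares"
      using range_ts by blast
    moreover have "ts n > 0"
      using that strict_mono_less[OF strict_mono_ts, of 0 n] by (simp add: ts_0)
    ultimately show ?thesis
      by (simp add: M_def)
  qed
  have idx: "idx x \<ge> 1" if x: "x \<in> M" for x
  proof -
    obtain m where "m \<ge> 1" "x = ts m"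
      using x pos_two_squares_conv_ts unfolding M_def by blast
    then show ?thesis
      by (simp add: idx_def card_two_squares_below_ts)
  qed
  have col: "c (idx x) \<in> {1..r}" if "x \<in> M" for x
    using assms(3) idx[OF that] by (auto simp: coloring_def)
  then have C: "(\<lambda>x. c (idx x)) \<in> M \<rightarrow> {1..r}"
    by blast
  obtain a d x P col where a: "a \<ge> 1" and d: "d \<ge> 1" and x: "x \<in> M" and P: "P \<in> M"
    and col: "col \<in> {1..r}"
    and mono: "\<And>i j. i \<le> k \<Longrightarrow> j \<le> k \<Longrightarrow> c (idx (x * (P * ts (a + i * d)) ^ j)) = col"
    by (rule geo_arithmetic[where k = k and f = ts, OF one mult tsM finite_atLeastAtMost C])
       (assumption+, rule that)
  have pow: "y ^ j \<in> M" if "y \<in> M" for y j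
    using that one mult by (induction j) auto
  obtain b where b: "b \<ge> 1" "x = ts b"
    using x pos_two_squares_conv_ts unfolding M_def by blast
  \<comment> \<open>The index of \<open>P\<close> is the only element of the witness for
    \<open>\<gamma>\<close>.\<close>
  obtain m where m: "m \<ge> 1" "P = ts m"
    using P pos_two_squares_conv_ts unfolding M_def by blast
  have "idx (x * (P * ts (a + i * d)) ^ j) \<in> color_class c col" if "i \<le> k" "j \<le> k" for i j
    using mono[OF that] idx[OF mult[OF x pow[OF mult[OF P tsM]]], of "a + i * d" j] a
    by (simp add: color_class_def)
  then have "monochromatic r c
      {card (two_squares_below (ts b * ((\<Prod>t\<in>{m}. ts t) * ts (a + i * d)) ^ j)) | i j.
         i \<in> {0..k} \<and> j \<in> {0..k}}"
    unfolding monochromatic_def using col by (intro bexI[of _ col]) (auto simp: idx_def b(2) m(2))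
  with a b(1) d m(1) show ?thesis
    by (intro exI[of _ a] exI[of _ b] exI[of _ d] exI[of _ "{m}"]) simp
qed

end
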